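(* If $G=(V,E)$ is a connected, $k$-regular (unweighted) graph on $n$ vertices, then $$\frac{1}{2n}-\sqrt{\frac{k-m(G)}{2k}}\ \leq\ q_G'\ \leq\ \frac{m(G)}{2k}.$$
   Context: $G=(V,E)$, $V=\{1,\dots,n\}$, is a finite simple undirected unweighted graph with 0/1 adjacency matrix $A$; $k$-regular means that every degree $d_i=\sum_j a_{ij}$ equals $k$. Put $d=(d_1,\dots,d_n)^T$ and $\mathrm{vol}\,G=\sum_i d_i$. The modularity matrix is $M=A-\frac{1}{\mathrm{vol}\,G}dd^T$. For $S\subseteq V$ with characteristic vector $\mathbf 1_S$, the modularity of $S$ is $Q(S)=\mathbf 1_S^TM\mathbf 1_S$; with $\bar S=V\setminus S$, set $q(S)=\frac{1}{\mathrm{vol}\,G}\big(Q(S)+Q(\bar S)\big)$ and $q_G'=\max_{S\subset V}q(S)$. The algebraic modularity of $G$ is $m(G)=\max_{0\neq x\in\mathbb{R}^n,\ x^T\mathbf 1=0}\frac{x^TMx}{x^Tx}$, where $\mathbf 1$ is the all-ones vector.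
   Formalization: Assumes n ≥ 2 (for n = 1, m(G) and the bounds are undefined), and the upper bound is claimed only for non-complete G: for complete graphs with n ≥ 2, m(G) = −1 while q(∅) = 0 gives q_G' ≥ 0, so the upper bound fails. The lower bound covers complete graphs too. *)

theory Defs
  imports "HOL-Analysis.Analysis"
begin

text \<open>A graph on \<open>n = CARD('n)\<close> vertices is given by its adjacency relation on the finite type
  \<open>'n\<close>, so that \<open>V = UNIV\<close> and \<open>\<real>\<^sup>n\<close> is the type \<open>real ^ 'n\<close>.\<close>

type_synonym 'n graph = "'n \<Rightarrow> 'n \<Rightarrow> bool"

definition simple_graph :: "'n graph \<Rightarrow> bool" where
  "simple_graph E \<longleftrightarrow> symp E \<and> irreflp E"

definition connected_graph :: "'n graph \<Rightarrow> bool" where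
  "connected_graph E \<longleftrightarrow> (\<forall>i j. E\<^sup>*\<^sup>* i j)"

definition complete_graph :: "'n graph \<Rightarrow> bool" where
  "complete_graph E \<longleftrightarrow> (\<forall>i j. i \<noteq> j \<longrightarrow> E i j)"

definition adjacency_matrix :: "'n::finite graph \<Rightarrow> real ^ 'n ^ 'n" where
  "adjacency_matrix E = (\<chi> i j. if E i j then 1 else 0)"

definition degree_vector :: "'n::finite graph \<Rightarrow> real ^ 'n" where
  "degree_vector E = (\<chi> i. \<Sum>j\<in>UNIV. adjacency_matrix E $ i $ j)"

definition regular_graph :: "nat \<Rightarrow> 'n::finite graph \<Rightarrow> bool" where
  "regular_graph k E \<longleftrightarrow> (\<forall>i. degree_vector E $ i = real k)"

definition volume :: "'n::finite graph \<Rightarrow> real" where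
  "volume E = (\<Sum>i\<in>UNIV. degree_vector E $ i)"

definition modularity_matrix :: "'n::finite graph \<Rightarrow> real ^ 'n ^ 'n" where
  "modularity_matrix E = adjacency_matrix E -
     (1 / volume E) *\<^sub>R (\<chi> i j. degree_vector E $ i * degree_vector E $ j)"

definition char_vec :: "'n set \<Rightarrow> real ^ 'n::finite" where
  "char_vec S = (\<chi> i. indicator S i)"

definition modularity :: "'n::finite graph \<Rightarrow> 'n set \<Rightarrow> real" where
  "modularity E S = char_vec S \<bullet> (modularity_matrix E *v char_vec S)"

definition cut_modularity :: "'n::finite graph \<Rightarrow> 'n set \<Rightarrow> real" where
  "cut_modularity E S = 1 / volume E * (modularity E S + modularity E (- S))"

text \<open>The maximum runs over all proper subsets, the empty one included.  Since
  \<open>cut_modularity E {} = cut_modularity E UNIV\<close>, admitting \<open>S = UNIV\<close> would not change the value.\<close>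

definition max_cut_modularity :: "'n::finite graph \<Rightarrow> real" where
  "max_cut_modularity E = Max (cut_modularity E ` {S. S \<subset> UNIV})"

text \<open>\<^const>\<open>Max\<close> is meaningless on infinite sets, so the maximum is taken as a supremum;
  it is attained as soon as there are two vertices, see \<open>algebraic_modularity_attained\<close>.\<close>

definition algebraic_modularity :: "'n::finite graph \<Rightarrow> real" where
  "algebraic_modularity E =
     (SUP x\<in>{x. x \<noteq> 0 \<and> x \<bullet> 1 = 0}. (x \<bullet> (modularity_matrix E *v x)) / (x \<bullet> x))"

lemma algebraic_modularity_attained:
  fixes E :: "'n::finite graph"
  assumes "CARD('n) \<ge> 2"
  obtains x where "x \<noteq> 0" "x \<bullet> 1 = 0"
    "algebraic_modularity E = (x \<bullet> (modularity_matrix E *v x)) / (x \<bullet> x)"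
    "\<And>y. y \<noteq> 0 \<Longrightarrow> y \<bullet> 1 = 0 \<Longrightarrow>
       (y \<bullet> (modularity_matrix E *v y)) / (y \<bullet> y) \<le> (x \<bullet> (modularity_matrix E *v x)) / (x \<bullet> x)"
proof -
  define M where "M = modularity_matrix E"
  define f where "f x = x \<bullet> (M *v x)" for x
  define K where "K = {x :: real ^ 'n. norm x = 1 \<and> x \<bullet> 1 = 0}"
  have scale: "f (y /\<^sub>R norm y) = f y / (y \<bullet> y)" for y
    by (simp add: f_def matrix_vector_mult_scaleR dot_square_norm power2_eq_square divide_simps)
  have inK: "y /\<^sub>R norm y \<in> K" if "y \<noteq> 0" "y \<bullet> 1 = 0" for y
    using that by (simp add: K_def)
  obtain a b :: 'n where "a \<noteq> b"
    using assms by (metis card_2_iff' card_le_Suc0_iff_eq finite UNIV_I not_less_eq_eq numeral_2_eq_2)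
  then have "(axis a 1 - axis b 1 :: real ^ 'n) \<noteq> 0" "(axis a 1 - axis b 1 :: real ^ 'n) \<bullet> 1 = 0"
    by (simp_all add: axis_eq_axis inner_diff_left inner_axis')
  then have "K \<noteq> {}" using inK by blast
  moreover have "compact K"
  proof -
    have "K = sphere 0 1 \<inter> {x. x \<bullet> 1 = 0}" by (auto simp: K_def)
    moreover have "closed {x :: real ^ 'n. x \<bullet> 1 = 0}"
      by (intro closed_Collect_eq continuous_intros)
    ultimately show ?thesis by (simp add: compact_Int_closed)
  qed
  moreover have "continuous_on K f"
    unfolding f_def by (intro continuous_intros matrix_vector_mult_linear_continuous_on)
  ultimately obtain x where x: "x \<in> K" "\<And>y. y \<in> K \<Longrightarrow> f y \<le> f x"
    using continuous_attains_sup by metis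
  have fx: "f x / (x \<bullet> x) = f x" using x(1) by (simp add: K_def dot_square_norm)
  have x0: "x \<noteq> 0" "x \<bullet> 1 = 0" using x(1) by (auto simp: K_def)
  have max: "f y / (y \<bullet> y) \<le> f x / (x \<bullet> x)" if "y \<noteq> 0" "y \<bullet> 1 = 0" for y
    using x(2)[OF inK[OF that]] by (simp add: scale fx)
  have "algebraic_modularity E = f x / (x \<bullet> x)"
    unfolding algebraic_modularity_def M_def[symmetric] f_def[symmetric]
    by (rule cSup_eq_maximum) (use x0 max in auto)
  with x0 max show ?thesis by (intro that[of x]) (auto simp: f_def M_def)
qed

text \<open>For complete graphs the upper bound \<open>max_cut_modularity E \<le> algebraic_modularity E / (2 * k)\<close>
  fails: its left-hand side is nonnegative and its right-hand side is negative.\<close>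

lemma max_cut_modularity_nonneg: "max_cut_modularity E \<ge> 0"
proof -
  have [simp]: "char_vec {} = (0 :: real ^ 'a)" "char_vec UNIV = (1 :: real ^ 'a)"
    by (simp_all add: char_vec_def vec_eq_iff)
  have "modularity E UNIV = (\<Sum>i\<in>UNIV. \<Sum>j\<in>UNIV. adjacency_matrix E $ i $ j
      - degree_vector E $ i * degree_vector E $ j / volume E)"
    by (simp add: modularity_def modularity_matrix_def inner_vec_def matrix_vector_mult_def)
  also have "\<dots> = volume E - volume E * volume E / volume E"
    by (simp add: sum_subtractf sum_product volume_def degree_vector_def sum_divide_distrib)
  finally have "modularity E UNIV = 0" by simp
  then have "cut_modularity E {} = 0"
    by (simp add: cut_modularity_def modularity_def)
  then show ?thesis
    unfolding max_cut_modularity_def by (intro Max_ge) (auto intro!: image_eqI[of _ _ "{}"])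
qed

lemma algebraic_modularity_complete:
  fixes E :: "'n::finite graph"
  assumes "simple_graph E" "complete_graph E" "CARD('n) \<ge> 2"
  shows "algebraic_modularity E = - 1"
proof -
  obtain x where x: "x \<noteq> 0" "x \<bullet> 1 = 0"
    "algebraic_modularity E = (x \<bullet> (modularity_matrix E *v x)) / (x \<bullet> x)"
    using algebraic_modularity_attained[OF assms(3)] by metis
  have E: "E i j \<longleftrightarrow> i \<noteq> j" for i j
    using assms by (auto simp: simple_graph_def complete_graph_def irreflp_def)
  have s: "(\<Sum>j\<in>UNIV. x $ j) = 0" using x(2) by (simp add: inner_vec_def)
  have "degree_vector E $ i = real (CARD('n) - 1)" for i
  proof -
    have "{j. i \<noteq> j} = UNIV - {i}" by auto
    then show ?thesis
      by (simp add: degree_vector_def adjacency_matrix_def E sum.If_cases)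
  qed
  then obtain d where d: "\<And>i. degree_vector E $ i = d" by metis
  have A: "(\<Sum>j\<in>UNIV. (if i \<noteq> j then 1 else 0) * x $ j) = - x $ i" for i
  proof -
    have "(\<Sum>j\<in>UNIV. (if i \<noteq> j then 1 else 0) * x $ j) = (\<Sum>j\<in>UNIV. x $ j - (if i = j then x $ j else 0))"
      by (intro sum.cong) auto
    also have "\<dots> = - x $ i" by (simp add: sum_subtractf s)
    finally show ?thesis .
  qed
  have "modularity_matrix E *v x = - x"
  proof -
    have "(modularity_matrix E *v x) $ i = - x $ i" for i
    proof -
      have "(modularity_matrix E *v x) $ i =
          (\<Sum>j\<in>UNIV. (if i \<noteq> j then 1 else 0) * x $ j - (d * d / volume E) * x $ j)"
        by (auto simp: modularity_matrix_def matrix_vector_mult_def adjacency_matrix_def E d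
            algebra_simps intro!: sum.cong)
      also have "\<dots> = - x $ i"
        by (simp only: sum_subtractf A sum_distrib_left[symmetric] s mult_zero_right diff_zero)
      finally show ?thesis .
    qed
    then show ?thesis by (simp add: vec_eq_iff)
  qed
  then show ?thesis using x by simp
qed

end

theory Submission
  imports Defs
begin

text \<open>
  The two inequalities are independent of each other, and both start from the same identity: for a
  \<open>k\<close>-regular graph, \<open>x\<^sup>T M x\<close> equals \<open>k |x|\<^sup>2\<close> minus the Dirichlet energy
  \<open>\<Sum> (x\<^sub>i - x\<^sub>j)\<^sup>2\<close> over the edges minus a multiple of \<open>(x\<^sup>T 1)\<^sup>2\<close>
  (\<open>regular_modularity_form\<close>).

  Upper bound.  The constant vector lies in the kernel of \<open>M\<close>, so \<open>Q(S)\<close> does not change when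
  \<open>1\<^sub>S\<close> is replaced by its projection to the orthogonal complement of \<open>1\<close>.  That projection has
  squared norm \<open>s (1 - s / n)\<close> with \<open>s = |S|\<close>, whence \<open>Q(S) \<le> m(G) s (1 - s / n)\<close>
  (\<open>modularity_le\<close>).  Replacing \<open>s (1 - s / n)\<close> by its maximum \<open>n / 4\<close> requires
  \<open>m(G) \<ge> 0\<close>, and this is where complete graphs have to be excluded: two non-adjacent vertices
  provide a test vector with Rayleigh quotient \<open>0\<close> (\<open>algebraic_modularity_nonneg\<close>).

  Lower bound.  Since the empty set gives \<open>q'\<^sub>G \<ge> 0\<close>, it is enough that the left-hand side is never
  positive, which amounts to \<open>k - m(G) \<ge> k / (2 n\<^sup>2)\<close>.  Such a bound on the spectral gap
  \<open>k - m(G)\<close> follows from the shape of shortest paths (\<open>spectral_gap_bound\<close>).  A maximiser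
  \<open>x\<close> of the Rayleigh quotient defining \<open>m(G)\<close> has mean zero, so the
  difference between its largest and its smallest entry is at least \<open>2 |x| / \<surd>n\<close>.  This difference has
  to be built up along a shortest path between the two extremal vertices, and by the Cauchy-Schwarz
  inequality a path of length \<open>l\<close> then carries a Dirichlet energy of order at least
  \<open>|x|\<^sup>2 / (n l)\<close>.  Finally, \<open>l\<close> is at most \<open>3 n / k\<close>: every vertex has at most three
  neighbours on a shortest path, while each vertex of the path has \<open>k\<close> neighbours.
\<close>

section \<open>The quadratic form of the modularity matrix\<close>

text \<open>The sum runs over ordered pairs, so every edge is counted twice.\<close>

definition dirichlet_energy :: "'n::finite graph \<Rightarrow> real ^ 'n \<Rightarrow> real" where
  "dirichlet_energy E x =
     (\<Sum>i\<in>UNIV. \<Sum>j\<in>UNIV. adjacency_matrix E $ i $ j * (x $ i - x $ j)\<^sup>2)"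

lemma regular_row_sum:
  fixes E :: "'n::finite graph"
  assumes "regular_graph k E"
  shows "(\<Sum>j\<in>UNIV. adjacency_matrix E $ i $ j) = real k"
  using assms by (simp add: regular_graph_def degree_vector_def)

lemma adjacency_matrix_commute:
  fixes E :: "'n::finite graph"
  assumes "simple_graph E"
  shows "adjacency_matrix E $ i $ j = adjacency_matrix E $ j $ i"
  using assms by (auto simp: simple_graph_def adjacency_matrix_def symp_def)

lemma regular_modularity_entry:
  fixes E :: "'n::finite graph"
  assumes "regular_graph k E"
  shows "modularity_matrix E $ i $ j = adjacency_matrix E $ i $ j - real k / real CARD('n)"
  using assms by (simp add: modularity_matrix_def regular_graph_def volume_def)

text \<open>This is \<open>M = (k I - L) - (k / n) J\<close> read as quadratic forms, where \<open>L\<close> is the graph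
  Laplacian and \<open>J\<close> the all-ones matrix.  Writing the form through differences of entries makes
  its behaviour under adding a constant vector visible.\<close>

lemma regular_modularity_form:
  fixes E :: "'n::finite graph"
  assumes "simple_graph E" and reg: "regular_graph k E"
  shows "x \<bullet> (modularity_matrix E *v x) =
    real k * (x \<bullet> x) - dirichlet_energy E x / 2 - real k / real CARD('n) * (x \<bullet> 1)\<^sup>2"
proof -
  let ?a = "\<lambda>i j. adjacency_matrix E $ i $ j"
  let ?T = "\<Sum>i\<in>UNIV. \<Sum>j\<in>UNIV. ?a i j * x $ i * x $ j"
  have "x \<bullet> (modularity_matrix E *v x) =
      (\<Sum>i\<in>UNIV. \<Sum>j\<in>UNIV. ?a i j * x $ i * x $ j - real k / real CARD('n) * (x $ i * x $ j))"
    unfolding inner_vec_def matrix_vector_mult_def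
    by (simp add: sum_distrib_left regular_modularity_entry[OF reg] algebra_simps)
  also have "\<dots> = ?T - real k / real CARD('n) * (x \<bullet> 1)\<^sup>2"
    by (simp only: sum_subtractf sum_distrib_left[symmetric] power2_eq_square sum_product
        inner_vec_def one_index inner_real_def mult_1_right)
  finally have form: "x \<bullet> (modularity_matrix E *v x) = ?T - real k / real CARD('n) * (x \<bullet> 1)\<^sup>2" .
  have diag: "(\<Sum>i\<in>UNIV. \<Sum>j\<in>UNIV. ?a i j * (x $ i)\<^sup>2) = real k * (x \<bullet> x)"
    by (simp add: sum_distrib_right[symmetric] regular_row_sum[OF reg])
      (simp add: inner_vec_def sum_distrib_left power2_eq_square)
  have "(\<Sum>i\<in>UNIV. \<Sum>j\<in>UNIV. ?a i j * (x $ j)\<^sup>2) = (\<Sum>i\<in>UNIV. \<Sum>j\<in>UNIV. ?a i j * (x $ i)\<^sup>2)"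
    by (subst sum.swap) (simp add: adjacency_matrix_commute[OF assms(1)])
  with diag have diag': "(\<Sum>i\<in>UNIV. \<Sum>j\<in>UNIV. ?a i j * (x $ j)\<^sup>2) = real k * (x \<bullet> x)"
    by simp
  have "dirichlet_energy E x = (\<Sum>i\<in>UNIV. \<Sum>j\<in>UNIV.
      ?a i j * (x $ i)\<^sup>2 + ?a i j * (x $ j)\<^sup>2 - 2 * (?a i j * x $ i * x $ j))"
    unfolding dirichlet_energy_def
    by (intro sum.cong refl) (simp add: power2_eq_square algebra_simps)
  also have "\<dots> = 2 * (real k * (x \<bullet> x)) - 2 * ?T"
    by (simp only: sum_subtractf sum.distrib diag diag' sum_distrib_left[symmetric])
  finally show ?thesis using form by linarith
qed

section \<open>The upper bound\<close>

lemma modularity_form_le_algebraic_modularity: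
  fixes E :: "'n::finite graph"
  assumes "CARD('n) \<ge> 2" and "x \<bullet> 1 = 0"
  shows "x \<bullet> (modularity_matrix E *v x) \<le> algebraic_modularity E * (x \<bullet> x)"
proof (cases "x = 0")
  case False
  have "(x \<bullet> (modularity_matrix E *v x)) / (x \<bullet> x) \<le> algebraic_modularity E"
    using algebraic_modularity_attained[OF assms(1), of E] assms(2) False by metis
  moreover have "x \<bullet> x > 0" using False by simp
  ultimately show ?thesis by (simp add: pos_divide_le_eq)
qed simp

text \<open>The test vector \<open>e\<^sub>i - e\<^sub>j\<close> for non-adjacent vertices \<open>i\<close> and \<open>j\<close> does not see the adjacency
  matrix at all, and the constant matrix that is subtracted from it vanishes on vectors of sum
  zero.\<close>

lemma algebraic_modularity_nonneg:
  fixes E :: "'n::finite graph"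
  assumes "simple_graph E" "regular_graph k E" "CARD('n) \<ge> 2" "\<not> complete_graph E"
  shows "algebraic_modularity E \<ge> 0"
proof -
  obtain i j where ij: "i \<noteq> j" "\<not> E i j" using assms(4) by (auto simp: complete_graph_def)
  have "\<not> E i i" "\<not> E j j" "\<not> E j i"
    using assms(1) ij by (auto simp: simple_graph_def irreflp_def symp_def)
  define x :: "real ^ 'n" where "x = axis i 1 - axis j 1"
  have M: "axis a 1 \<bullet> (modularity_matrix E *v axis b 1) = modularity_matrix E $ a $ b" for a b
    by (simp add: inner_axis' matrix_vector_mult_basis column_def)
  have "x \<bullet> (modularity_matrix E *v x) = 0"
    unfolding x_def using \<open>\<not> E i i\<close> \<open>\<not> E j j\<close> \<open>\<not> E j i\<close> ij
    by (simp add: inner_diff matrix_vector_mult_diff_distrib M regular_modularity_entry[OF assms(2)]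
        adjacency_matrix_def)
  moreover have "x \<bullet> 1 = 0" by (simp add: x_def inner_diff_left inner_axis')
  ultimately have "0 \<le> algebraic_modularity E * (x \<bullet> x)"
    using modularity_form_le_algebraic_modularity[OF assms(3), of x E] by simp
  moreover have "x \<noteq> 0" using ij by (simp add: x_def axis_eq_axis)
  then have "x \<bullet> x > 0" by simp
  ultimately show ?thesis by (meson not_less mult_neg_pos)
qed

lemma dirichlet_energy_translate: "dirichlet_energy E (x - c *\<^sub>R 1) = dirichlet_energy E x"
  by (simp add: dirichlet_energy_def)

text \<open>Centring \<open>1\<^sub>S\<close> makes it admissible for the Rayleigh quotient and leaves the quadratic form
  unchanged.  The estimate holds for \<open>S = {}\<close> and \<open>S = UNIV\<close> as well, where the centred vector
  is zero.\<close>

lemma modularity_le: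
  fixes E :: "'n::finite graph"
  assumes "simple_graph E" "regular_graph k E" "CARD('n) \<ge> 2"
  shows "modularity E S \<le>
    algebraic_modularity E * (real (card S) * (1 - real (card S) / real CARD('n)))"
proof -
  define s n where "s = real (card S)" and "n = real CARD('n)"
  have n: "n > 0" by (simp add: n_def)
  define y where "y = char_vec S - (s / n) *\<^sub>R (1 :: real ^ 'n)"
  have one: "(1 :: real ^ 'n) \<bullet> 1 = n" by (simp add: inner_vec_def n_def)
  have S1: "char_vec S \<bullet> 1 = s"
    by (simp add: inner_vec_def char_vec_def s_def sum.If_cases indicator_def)
  have SS: "char_vec S \<bullet> char_vec S = s"
    by (simp add: inner_vec_def char_vec_def s_def indicator_def if_distrib sum.If_cases cong: if_cong)
  have y1: "y \<bullet> 1 = 0" using n by (simp add: y_def inner_diff_left S1 one)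
  have yy: "y \<bullet> y = s * (1 - s / n)"
  proof -
    have "1 \<bullet> char_vec S = s" using S1 by (simp add: inner_commute)
    then have "y \<bullet> y = s - s / n * s - (s / n * s - s / n * (s / n * n))"
      by (simp add: y_def inner_diff_left inner_diff_right SS S1 one)
    then show ?thesis using n by (simp add: algebra_simps)
  qed
  have "modularity E S = real k * s - dirichlet_energy E (char_vec S) / 2 - real k / n * s\<^sup>2"
    unfolding modularity_def regular_modularity_form[OF assms(1,2)] SS S1 n_def by simp
  also have "\<dots> = y \<bullet> (modularity_matrix E *v y)"
    unfolding regular_modularity_form[OF assms(1,2)] y1 yy
    by (simp add: y_def dirichlet_energy_translate power2_eq_square algebra_simps)
  also have "\<dots> \<le> algebraic_modularity E * (y \<bullet> y)"
    by (rule modularity_form_le_algebraic_modularity[OF assms(3) y1])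
  finally show ?thesis by (simp add: yy s_def n_def)
qed

text \<open>A set and its complement satisfy the same estimate, so each contributes at most
  \<open>m(G) n / 4\<close> to a quotient with denominator \<open>n k\<close>.\<close>

lemma max_cut_modularity_le:
  fixes E :: "'n::finite graph"
  assumes "simple_graph E" "regular_graph k E" "CARD('n) \<ge> 2" "\<not> complete_graph E"
  shows "max_cut_modularity E \<le> algebraic_modularity E / (2 * real k)"
proof -
  define n where "n = real CARD('n)"
  have n: "n > 0" by (simp add: n_def)
  have vol: "volume E = n * real k"
    using assms(2) by (simp add: volume_def regular_graph_def n_def)
  have mod: "modularity E S \<le> algebraic_modularity E * (n / 4)" for S
  proof -
    define s where "s = real (card S)"
    have "n / 4 - s * (1 - s / n) = (n - 2 * s)\<^sup>2 / (4 * n)"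
      using n by (simp add: field_simps power2_eq_square)
    also have "\<dots> \<ge> 0" using n by simp
    finally have "s * (1 - s / n) \<le> n / 4" by simp
    then have "algebraic_modularity E * (s * (1 - s / n)) \<le> algebraic_modularity E * (n / 4)"
      using algebraic_modularity_nonneg[OF assms] by (rule mult_left_mono)
    then show ?thesis
      using modularity_le[OF assms(1-3), of S] unfolding s_def n_def by (rule order_trans[rotated])
  qed
  have "cut_modularity E S \<le> algebraic_modularity E / (2 * real k)" for S
  proof -
    have "cut_modularity E S \<le> 1 / volume E * (algebraic_modularity E * (n / 2))"
      unfolding cut_modularity_def using mod[of S] mod[of "- S"] n
      by (intro mult_left_mono) (auto simp: vol)
    also have "\<dots> = algebraic_modularity E / (2 * real k)" using n by (simp add: vol)
    finally show ?thesis .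
  qed
  then show ?thesis
    unfolding max_cut_modularity_def by (subst Max_le_iff) auto
qed

section \<open>Shortest paths in regular graphs\<close>

text \<open>The second conjunct says that the path is a shortest walk between any two of its vertices,
  which is how it is used below; minimality between the two ends alone would give the same notion.\<close>

definition geodesic :: "'n graph \<Rightarrow> nat \<Rightarrow> (nat \<Rightarrow> 'n) \<Rightarrow> bool" where
  "geodesic E l p \<longleftrightarrow> (\<forall>t<l. E (p t) (p (Suc t))) \<and>
     (\<forall>a b m. a \<le> b \<longrightarrow> b \<le> l \<longrightarrow> (E ^^ m) (p a) (p b) \<longrightarrow> b - a \<le> m)"

lemma path_relpowp:
  assumes "\<forall>t<l. E (p t) (p (Suc t))" "a \<le> b" "b \<le> l"
  shows "(E ^^ (b - a)) (p a) (p b)"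
  unfolding relpowp_fun_conv using assms by (intro exI[of _ "\<lambda>t. p (a + t)"]) auto

text \<open>A walk of minimal length between its ends is minimal between any two of its vertices, because a
  shorter detour in the middle would shorten the whole walk.\<close>

lemma geodesic_exists:
  assumes "connected_graph E"
  obtains l p where "geodesic E l p" "p 0 = i" "p l = j"
proof -
  have ex: "\<exists>l. (E ^^ l) i j"
    using assms by (auto simp: connected_graph_def dest: rtranclp_imp_relpowp)
  define l where "l = (LEAST l. (E ^^ l) i j)"
  have "(E ^^ l) i j" unfolding l_def by (rule LeastI_ex[OF ex])
  then obtain p where p: "p 0 = i" "p l = j" and path: "\<forall>t<l. E (p t) (p (Suc t))"
    by (auto simp: relpowp_fun_conv)
  have "b - a \<le> m" if "a \<le> b" "b \<le> l" "(E ^^ m) (p a) (p b)" for a b m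
  proof -
    have "(E ^^ a) i (p a)" "(E ^^ (l - b)) (p b) j"
      using path_relpowp[of l E p 0 a] path_relpowp[of l E p b l] path that p by simp_all
    then have "(E ^^ (a + m + (l - b))) i j"
      using that(3) by (auto simp: relpowp_add)
    then have "l \<le> a + m + (l - b)" unfolding l_def by (rule Least_le)
    then show ?thesis using that by linarith
  qed
  then have "geodesic E l p" using path unfolding geodesic_def by blast
  then show ?thesis using p by (rule that)
qed

lemma geodesic_inj_on:
  assumes "geodesic E l p"
  shows "inj_on p {..l}"
proof (rule linorder_inj_onI)
  fix a b assume "a < b" "a \<in> {..l}" "b \<in> {..l}"
  then show "p a \<noteq> p b"
    using assms[unfolded geodesic_def, THEN conjunct2, rule_format, of a b 0] by auto
qed auto

text \<open>Two vertices of the path with a common neighbour are at distance at most two, so all neighbours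
  of \<open>w\<close> on the path lie within two steps of the first one.\<close>

lemma geodesic_neighbours:
  assumes "symp E" "geodesic E l p"
  shows "card {t \<in> {..l}. E w (p t)} \<le> 3"
proof (cases "{t \<in> {..l}. E w (p t)} = {}")
  case False
  let ?T = "{t \<in> {..l}. E w (p t)}"
  define a where "a = Min ?T"
  have a: "a \<in> ?T" unfolding a_def using False by (intro Min_in) auto
  have "?T \<subseteq> {a..a + 2}"
  proof
    fix b assume b: "b \<in> ?T"
    then have "a \<le> b" unfolding a_def by (intro Min_le) auto
    moreover have "(E ^^ 2) (p a) (p b)"
      using a b assms(1) by (auto simp: numeral_2_eq_2 symp_def)
    then have "b - a \<le> 2" if "a \<le> b" using assms(2) b that by (auto simp: geodesic_def)
    ultimately show "b \<in> {a..a + 2}" by auto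
  qed
  then have "card ?T \<le> card {a..a + 2}" by (intro card_mono) auto
  then show ?thesis by simp
next
  case True
  then show ?thesis by (simp only: card.empty)
qed

text \<open>Double counting of the pairs consisting of a vertex of the path and one of its neighbours.\<close>

lemma geodesic_length:
  fixes E :: "'n::finite graph"
  assumes "simple_graph E" "regular_graph k E" "geodesic E l p"
  shows "l * k \<le> 3 * CARD('n)"
proof -
  have sym: "symp E" using assms(1) by (simp add: simple_graph_def)
  let ?a = "\<lambda>i j. adjacency_matrix E $ i $ j"
  have "real (l * k) \<le> real (Suc l) * real k" by (simp add: algebra_simps)
  also have "\<dots> = (\<Sum>t\<le>l. \<Sum>w\<in>UNIV. ?a (p t) w)"
    by (simp add: regular_row_sum[OF assms(2)])
  also have "\<dots> = (\<Sum>w\<in>UNIV. \<Sum>t\<le>l. ?a (p t) w)"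
    by (rule sum.swap)
  also have "\<dots> = (\<Sum>w\<in>UNIV. real (card {t \<in> {..l}. E w (p t)}))"
    by (subst adjacency_matrix_commute[OF assms(1)])
      (simp add: adjacency_matrix_def sum.If_cases Int_def)
  also have "\<dots> \<le> (\<Sum>w\<in>(UNIV :: 'n set). 3)"
    by (intro sum_mono) (use geodesic_neighbours[OF sym assms(3)] in force)
  also have "\<dots> = real (3 * CARD('n))" by simp
  finally show ?thesis by linarith
qed

text \<open>Cauchy-Schwarz, applied to the increments of \<open>x\<close> along the path.  The edges of the path are
  distinct, so their squared increments form a part of the Dirichlet energy.  Only one of the two
  orientations of each edge is used here; the factor two that this loses is harmless for the
  bound on the spectral gap.\<close>

lemma geodesic_dirichlet_energy:
  fixes E :: "'n::finite graph"
  assumes "geodesic E l p"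
  shows "(x $ p l - x $ p 0)\<^sup>2 \<le> real l * dirichlet_energy E x"
proof -
  let ?d = "\<lambda>t. x $ p (Suc t) - x $ p t"
  let ?e = "\<lambda>(i, j). adjacency_matrix E $ i $ j * (x $ i - x $ j)\<^sup>2"
  have path: "E (p t) (p (Suc t))" if "t < l" for t using assms that by (simp add: geodesic_def)
  have inj: "inj_on (\<lambda>t. (p t, p (Suc t))) {..<l}"
    using geodesic_inj_on[OF assms] by (auto simp: inj_on_def)
  have "(x $ p l - x $ p 0)\<^sup>2 = (\<Sum>t<l. ?d t)\<^sup>2" by (simp add: sum_lessThan_telescope[of "\<lambda>t. x $ p t"])
  also have "\<dots> \<le> (\<Sum>t<l. (?d t)\<^sup>2) * real (card {..<l})"
    by (rule sum_squared_le_sum_of_squares)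
  also have "(\<Sum>t<l. (?d t)\<^sup>2) = (\<Sum>t<l. ?e (p t, p (Suc t)))"
    by (intro sum.cong) (auto simp: adjacency_matrix_def path power2_commute)
  also have "\<dots> = (\<Sum>e\<in>(\<lambda>t. (p t, p (Suc t))) ` {..<l}. ?e e)"
    by (simp add: sum.reindex[OF inj])
  also have "\<dots> \<le> (\<Sum>e\<in>UNIV. ?e e)"
    by (intro sum_mono2) (auto simp: adjacency_matrix_def)
  also have "\<dots> = dirichlet_energy E x"
    by (simp add: dirichlet_energy_def sum.cartesian_product)
  finally show ?thesis by (simp add: mult.commute mult_right_mono)
qed

section \<open>A lower bound for the spectral gap\<close>

text \<open>Summing \<open>(b - x\<^sub>v) (x\<^sub>v - a) \<ge> 0\<close> over all \<open>v\<close> removes the linear term and leaves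
  \<open>|x|\<^sup>2 \<le> - n a b\<close>; moreover \<open>- 4 a b \<le> (b - a)\<^sup>2\<close>.\<close>

lemma range_ge_of_sum_zero:
  fixes x :: "real ^ 'n::finite"
  assumes "x \<bullet> 1 = 0" "\<And>v. a \<le> x $ v" "\<And>v. x $ v \<le> b"
  shows "4 * (x \<bullet> x) \<le> real CARD('n) * (b - a)\<^sup>2"
proof -
  have s: "(\<Sum>v\<in>UNIV. x $ v) = 0" using assms(1) by (simp add: inner_vec_def)
  have "0 \<le> (\<Sum>v\<in>UNIV. (b - x $ v) * (x $ v - a))"
    by (intro sum_nonneg mult_nonneg_nonneg) (simp_all add: assms)
  also have "\<dots> = (\<Sum>v\<in>UNIV. (a + b) * x $ v - x $ v * x $ v - a * b)"
    by (intro sum.cong) (simp_all add: algebra_simps)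
  also have "\<dots> = - (x \<bullet> x) - real CARD('n) * (a * b)"
    by (simp add: sum_subtractf sum_distrib_left[symmetric] s inner_vec_def)
  finally have "4 * (x \<bullet> x) \<le> real CARD('n) * (- 4 * (a * b))"
    by (simp add: algebra_simps)
  also have "\<dots> \<le> real CARD('n) * (b - a)\<^sup>2"
  proof (rule mult_left_mono)
    show "- 4 * (a * b) \<le> (b - a)\<^sup>2"
      using zero_le_power2[of "a + b"] by (simp add: power2_eq_square algebra_simps)
  qed simp
  finally show ?thesis .
qed

text \<open>With \<open>g = k - m(G)\<close>, a maximiser \<open>x\<close> of the Rayleigh quotient has Dirichlet energy
  \<open>2 g |x|\<^sup>2\<close>.  A shortest path of length \<open>l\<close> from a minimum to a maximum of \<open>x\<close> therefore
  gives \<open>4 |x|\<^sup>2 / n \<le> 2 l g |x|\<^sup>2\<close>, and \<open>l k \<le> 3 n\<close> eliminates \<open>l\<close>.\<close>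

lemma spectral_gap_bound:
  fixes E :: "'n::finite graph"
  assumes "simple_graph E" "connected_graph E" "regular_graph k E" "CARD('n) \<ge> 2"
  shows "2 * real k \<le> 3 * (real CARD('n))\<^sup>2 * (real k - algebraic_modularity E)"
proof -
  define n where "n = real CARD('n)"
  have n: "n > 0" by (simp add: n_def)
  obtain x where x: "x \<noteq> 0" "x \<bullet> 1 = 0"
    and m: "algebraic_modularity E = (x \<bullet> (modularity_matrix E *v x)) / (x \<bullet> x)"
    using algebraic_modularity_attained[OF assms(4)] by metis
  have xx: "x \<bullet> x > 0" using x by simp
  define g where "g = real k - algebraic_modularity E"
  have energy: "dirichlet_energy E x = 2 * g * (x \<bullet> x)"
    using xx unfolding g_def m regular_modularity_form[OF assms(1,3)] x(2)
    by (simp add: field_simps)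
  have "Min (range (($) x)) \<in> range (($) x)" "Max (range (($) x)) \<in> range (($) x)"
    by (intro Min_in Max_in; simp)+
  then obtain i j where i: "Min (range (($) x)) = x $ i" and j: "Max (range (($) x)) = x $ j"
    by (metis imageE)
  have "x $ i \<le> x $ v" "x $ v \<le> x $ j" for v
    unfolding i[symmetric] j[symmetric] by (auto intro: Min_le Max_ge)
  then have range: "4 * (x \<bullet> x) \<le> n * (x $ j - x $ i)\<^sup>2"
    unfolding n_def by (intro range_ge_of_sum_zero x)
  obtain l p where p: "geodesic E l p" "p 0 = i" "p l = j"
    using geodesic_exists[OF assms(2)] by metis
  have "(x $ j - x $ i)\<^sup>2 \<le> real l * (2 * g * (x \<bullet> x))"
    using geodesic_dirichlet_energy[OF p(1), of x] by (simp add: p energy)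
  then have "n * (x $ j - x $ i)\<^sup>2 \<le> n * (real l * (2 * g * (x \<bullet> x)))"
    using n by (intro mult_left_mono) auto
  with range have "4 * (x \<bullet> x) \<le> n * (real l * (2 * g * (x \<bullet> x)))" by (rule order_trans)
  also have "\<dots> = (n * real l * 2 * g) * (x \<bullet> x)" by (simp add: mult_ac)
  finally have lg: "2 \<le> n * real l * g" using xx by (simp add: mult_ac)
  have g: "g \<ge> 0"
  proof -
    have "0 \<le> dirichlet_energy E x"
      by (auto simp: dirichlet_energy_def adjacency_matrix_def intro!: sum_nonneg)
    then show ?thesis using xx by (simp add: energy zero_le_mult_iff)
  qed
  have "real (l * k) \<le> real (3 * CARD('n))"
    using geodesic_length[OF assms(1,3) p(1)] of_nat_mono by blast
  then have lk: "real l * real k \<le> 3 * n" by (simp add: n_def)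
  have "2 * real k \<le> n * real l * g * real k" using lg by (intro mult_right_mono) auto
  also have "\<dots> = n * g * (real l * real k)" by simp
  also have "\<dots> \<le> n * g * (3 * n)" using lk n g by (intro mult_left_mono) auto
  finally show ?thesis by (simp add: n_def g_def power2_eq_square mult_ac)
qed

lemma connected_regular_degree_pos:
  fixes E :: "'n::finite graph"
  assumes "connected_graph E" "regular_graph k E" "CARD('n) \<ge> 2"
  shows "k > 0"
proof -
  obtain i j :: 'n where "i \<noteq> j"
    using assms(3) by (metis card_2_iff' card_le_Suc0_iff_eq finite UNIV_I not_less_eq_eq numeral_2_eq_2)
  moreover have "E\<^sup>*\<^sup>* i j" using assms(1) by (simp add: connected_graph_def)
  ultimately obtain w where w: "E i w" by (metis converse_rtranclpE)
  have "1 = adjacency_matrix E $ i $ w" using w by (simp add: adjacency_matrix_def)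
  also have "\<dots> \<le> (\<Sum>j\<in>UNIV. adjacency_matrix E $ i $ j)"
    by (rule member_le_sum) (auto simp: adjacency_matrix_def)
  finally show ?thesis by (simp add: regular_row_sum[OF assms(2)])
qed

theorem corollary7p2:
  fixes E :: "'n::finite graph" and k :: nat
  assumes "simple_graph E" and "connected_graph E" and "regular_graph k E"
    and "CARD('n) \<ge> 2"
  shows "1 / (2 * real CARD('n)) - sqrt ((real k - algebraic_modularity E) / (2 * real k))
           \<le> max_cut_modularity E
       \<and> (\<not> complete_graph E \<longrightarrow> max_cut_modularity E \<le> algebraic_modularity E / (2 * real k))"
proof (intro conjI impI)
  define n where "n = real CARD('n)"
  have n: "n > 0" by (simp add: n_def)
  have k: "real k > 0" using connected_regular_degree_pos[OF assms(2-4)] by simp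
  have "2 * real k \<le> 3 * n\<^sup>2 * (real k - algebraic_modularity E)"
    unfolding n_def by (rule spectral_gap_bound[OF assms])
  \<comment> \<open>The gap bound says that the radicand is at least \<open>1 / (3 n\<^sup>2)\<close>, which exceeds \<open>1 / (4 n\<^sup>2)\<close>.\<close>
  then have "(1 / (2 * n))\<^sup>2 \<le> (real k - algebraic_modularity E) / (2 * real k)"
    using n k by (simp add: field_simps power2_eq_square)
  then have "1 / (2 * n) \<le> sqrt ((real k - algebraic_modularity E) / (2 * real k))"
    by (rule real_le_rsqrt)
  then show "1 / (2 * real CARD('n)) - sqrt ((real k - algebraic_modularity E) / (2 * real k))
      \<le> max_cut_modularity E"
    using max_cut_modularity_nonneg[of E] by (simp add: n_def)
next
  assume "\<not> complete_graph E"
  then show "max_cut_modularity E \<le> algebraic_modularity E / (2 * real k)"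
    by (rule max_cut_modularity_le[OF assms(1,3,4)])
qed

end
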